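(* The asymptotic random order ratio of Best Fit satisfies $RR^\infty_{\mathrm{BF}} > 1.10$.
   Context: Bin packing: given a list $I=(x_1,\ldots,x_n)$ of items with sizes in $(0,1]$, a packing assigns items to unit-capacity bins so that the total size of items in each bin is at most $1$. $\mathrm{OPT}(I)$ denotes the minimum number of bins in a feasible packing. The online algorithm Best Fit (BF) processes the items in the given order and packs the current item into the fullest bin (largest current load) into which it fits, opening a new bin if it fits into no existing bin; items are never moved. $\mathrm{BF}(I)$ denotes the number of bins Best Fit uses on list $I$. For $\sigma\in\mathcal{S}_n$ (permutations of $[n]$), $I^\sigma=(x_{\sigma(1)},\ldots,x_{\sigma(n)})$. With $\mathcal{I}$ the set of all finite item lists and $\sigma$ uniformly random in $\mathcal{S}_n$ ($n$ the length of $I$), the asymptotic random order ratio is $$RR^\infty_{\mathrm{BF}}=\limsup_{k\to\infty}\ \sup_{I\in\mathcal{I}}\left\{\frac{\mathbb{E}[\mathrm{BF}(I^\sigma)]}{\mathrm{OPT}(I)} \;\middle|\; \mathrm{OPT}(I)=k\right\}.$$ *)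

theory Defs
  imports "HOL-Analysis.Analysis" "HOL-Combinatorics.Permutations" "HOL-Library.Liminf_Limsup"
begin

definition valid_items :: "real list \<Rightarrow> bool" where
  "valid_items I \<longleftrightarrow> (\<forall>x\<in>set I. 0 < x \<and> x \<le> 1)"

definition feasible_packing :: "real list \<Rightarrow> nat \<Rightarrow> (nat \<Rightarrow> nat) \<Rightarrow> bool" where
  "feasible_packing I k f \<longleftrightarrow>
     (\<forall>i<length I. f i < k) \<and>
     (\<forall>b<k. (\<Sum>i\<in>{i. i < length I \<and> f i = b}. I ! i) \<le> 1)"

definition OPT :: "real list \<Rightarrow> nat" where
  "OPT I = (LEAST k. \<exists>f. feasible_packing I k f)"

definition bf_insert :: "real list \<Rightarrow> real \<Rightarrow> real list" where
  "bf_insert L x =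
     (let C = filter (\<lambda>j. L ! j + x \<le> 1) [0..<length L] in
      if C = [] then L @ [x]
      else let m = Max (set (map (\<lambda>j. L ! j) C));
               j = hd (filter (\<lambda>j. L ! j = m) C)
           in L[j := L ! j + x])"

definition BF :: "real list \<Rightarrow> nat" where
  "BF I = length (foldl bf_insert [] I)"

definition expected_BF :: "real list \<Rightarrow> real" where
  "expected_BF I =
     (\<Sum>\<sigma>\<in>{\<sigma>. \<sigma> permutes {..<length I}}. real (BF (map (\<lambda>i. I ! \<sigma> i) [0..<length I])))
       / fact (length I)"

definition RR_inf_BF :: ereal where
  "RR_inf_BF = limsup (\<lambda>k::nat.
      SUP I\<in>{I. valid_items I \<and> OPT I = k}. ereal (expected_BF I / real (OPT I)))"

end

theory Submission
  imports Defs
begin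

text \<open>
  Draw every item independently and uniformly from the two sizes \<open>1/4\<close> and \<open>1/3\<close>. A bin of load
  above \<open>3/4\<close> never receives an item again, and the loads of the other bins of Best Fit only take
  nine configurations. So Best Fit runs a Markov chain on nine states; in the long run it opens
  \<open>60/187\<close> bins per item, whereas an optimal packing needs at most two bins more than the total
  size, which is \<open>7/24\<close> per item on average, and \<open>(60/187)/(7/24) = 1440/1309 > 1.10005\<close>. The
  solution of the Poisson equation of the chain is a potential that gives the expected number of bins
  by induction. The uniform distribution on words is invariant under permuting positions, so
  averaging the random order cost over all words gives the same value, and some word attains at least
  the average ratio.
\<close>

section \<open>Words over two item sizes\<close>

text \<open>A word is encoded by the set of positions that carry \<open>1/4\<close>, so a uniform
  average over words becomes a sum over \<open>Pow {..<n}\<close>.\<close>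

definition word :: "nat \<Rightarrow> nat set \<Rightarrow> real list" where
  "word n A = map (\<lambda>i. if i \<in> A then 1/4 else 1/3) [0..<n]"

lemma length_word [simp]: "length (word n A) = n"
  by (simp add: word_def)

lemma nth_word: "i < n \<Longrightarrow> word n A ! i = (if i \<in> A then 1/4 else 1/3)"
  by (simp add: word_def)

lemma valid_items_word: "valid_items (word n A)"
  by (auto simp: valid_items_def word_def)

lemma word_Suc:
  assumes "A \<subseteq> {..<n}"
  shows "word (Suc n) A = word n A @ [1/3]"
    and "word (Suc n) (insert n A) = word n A @ [1/4]"
proof -
  have "n \<notin> A" using assms by auto
  then show "word (Suc n) A = word n A @ [1/3]" "word (Suc n) (insert n A) = word n A @ [1/4]"
    by (auto simp: word_def)
qed

lemma permuted_word:
  assumes "\<sigma> permutes {..<n}"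
  shows "map (\<lambda>i. word n A ! \<sigma> i) [0..<n] = word n (\<sigma> -` A)"
proof -
  have "\<sigma> i < n" if "i < n" for i
    using permutes_in_image[OF assms, of i] that by simp
  then show ?thesis by (auto simp: word_def)
qed

text \<open>Splitting by whether the new position \<open>n\<close> lies in the set is conditioning
  on the last item; this drives the inductions over \<open>n\<close>.\<close>

lemma sum_Pow_lessThan_Suc:
  fixes h :: "nat set \<Rightarrow> 'a::comm_monoid_add"
  shows "(\<Sum>A\<in>Pow {..<Suc n}. h A) = (\<Sum>A\<in>Pow {..<n}. h A + h (insert n A))"
proof -
  have inj: "inj_on (insert n) (Pow {..<n})"
    by (rule inj_onI) (metis PowD insert_ident lessThan_iff less_irrefl subsetD)
  have "Pow {..<n} \<inter> insert n ` Pow {..<n} = {}" by auto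
  then show ?thesis
    by (simp add: lessThan_Suc Pow_insert sum.union_disjoint sum.reindex[OF inj] sum.distrib)
qed

subsection \<open>Best Fit on items of size \<open>1/4\<close> and \<open>1/3\<close>\<close>

lemma bf_insert_new:
  assumes "\<And>y. y \<in> set L \<Longrightarrow> \<not> y + x \<le> 1"
  shows "bf_insert L x = L @ [x]"
proof -
  have "filter (\<lambda>j. L ! j + x \<le> 1) [0..<length L] = []"
    using assms by (auto simp: filter_empty_conv)
  then show ?thesis by (simp add: bf_insert_def)
qed

text \<open>Ties among fullest bins go to the leftmost one, by \<open>hd\<close>;
  \<open>m \<notin> set A\<close> makes the displayed \<open>m\<close> that bin.\<close>

lemma bf_insert_fullest:
  assumes "m \<notin> set A" "m + x \<le> 1" "\<And>y. y \<in> set (A @ m # B) \<Longrightarrow> y + x \<le> 1 \<Longrightarrow> y \<le> m"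
  shows "bf_insert (A @ m # B) x = A @ (m + x) # B"
proof -
  let ?L = "A @ m # B"
  let ?C = "filter (\<lambda>j. ?L ! j + x \<le> 1) [0..<length ?L]"
  have mem: "length A \<in> set ?C" using assms(2) by simp
  then have ne: "?C \<noteq> []" by (metis empty_iff empty_set)
  have Max: "Max (set (map (\<lambda>j. ?L ! j) ?C)) = m"
  proof (rule Max_eqI)
    show "m \<in> set (map (\<lambda>j. ?L ! j) ?C)"
      unfolding set_map by (rule image_eqI[OF _ mem]) simp
    show "y \<le> m" if "y \<in> set (map (\<lambda>j. ?L ! j) ?C)" for y
    proof -
      from that obtain j where j: "j \<in> set ?C" "y = ?L ! j"
        unfolding set_map by blast
      then have "j < length ?L" "y + x \<le> 1"
        by (simp_all only: set_filter set_upt mem_Collect_eq atLeastLessThan_iff)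
      then show ?thesis using assms(3)[of y] nth_mem[of j ?L] j(2) by metis
    qed
  qed simp
  have upt: "[0..<length ?L] = [0..<length A] @ length A # [Suc (length A)..<length ?L]"
    using upt_add_eq_append[of 0 "length A" "Suc (length B)"]
    by (simp add: upt_conv_Cons del: upt_Suc)
  have none: "filter (\<lambda>j. ?L ! j = m) (filter (\<lambda>j. ?L ! j + x \<le> 1) [0..<length A]) = []"
    using assms(1) by (auto simp: filter_empty_conv nth_append)
  have hd: "hd (filter (\<lambda>j. ?L ! j = m) ?C) = length A"
    unfolding upt filter_append none using assms(2) by simp
  show ?thesis
    unfolding bf_insert_def Let_def Max hd using ne by (simp add: list_update_append)
qed

text \<open>Best Fit ignores every bin that cannot take the item, so such bins may be filtered out.\<close>

lemma bf_insert_filter: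
  assumes P: "\<And>y. y + x \<le> 1 \<Longrightarrow> P y"
  shows "filter P (bf_insert L x) = filter P (bf_insert (filter P L) x)" (is ?filter)
    and "length (bf_insert L x) + length (filter P L)
         = length L + length (bf_insert (filter P L) x)" (is ?length)
proof -
  have "?filter \<and> ?length"
  proof (cases "\<exists>y\<in>set L. y + x \<le> 1")
    case False
    then have "bf_insert L x = L @ [x]" "bf_insert (filter P L) x = filter P L @ [x]"
      by (auto intro!: bf_insert_new)
    then show ?thesis by simp
  next
    case True
    define m where "m = Max {y \<in> set L. y + x \<le> 1}"
    have m: "m \<in> set L" "m + x \<le> 1"
      using Max_in[of "{y \<in> set L. y + x \<le> 1}"] True by (auto simp: m_def)
    have le: "y \<le> m" if "y \<in> set L" "y + x \<le> 1" for y
      using that by (auto simp: m_def)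
    \<comment> \<open>The leftmost fullest bin that can take the item survives the filter, so both
      insertions change the same bin.\<close>
    obtain A B where L: "L = A @ m # B" "m \<notin> set A"
      using split_list_first[OF m(1)] by blast
    have 1: "bf_insert L x = A @ (m + x) # B"
      unfolding L(1) by (rule bf_insert_fullest) (use L m le in auto)
    have "bf_insert (filter P A @ m # filter P B) x = filter P A @ (m + x) # filter P B"
      by (rule bf_insert_fullest) (use L m le in auto)
    moreover have "filter P L = filter P A @ m # filter P B"
      using P[OF m(2)] L by simp
    ultimately show ?thesis using 1 L by simp
  qed
  then show ?filter ?length by auto
qed

section \<open>The chain of open bins and its potential\<close>

abbreviation open_bins :: "real list \<Rightarrow> real list" where
  "open_bins \<equiv> filter (\<lambda>y. y \<le> 3/4)"

definition configurations :: "real list set" where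
  "configurations = {[], [1/4], [1/3], [1/2], [7/12], [2/3], [3/4], [3/4, 1/3], [3/4, 2/3]}"

text \<open>
  The function \<open>h = potential / 187\<close> solves the Poisson equation of the chain: in every configuration,
  the expected number of new bins plus the expected change of \<open>h\<close> is exactly \<open>60/187\<close>.
\<close>

definition potential :: "real list \<Rightarrow> real" where
  "potential K =
    (if K = [] then 0 else if K = [1/4] then - 134 else if K = [1/3] then - 120
     else if K = [1/2] then - 88 else if K = [7/12] then - 60 else if K = [2/3] then - 60
     else if K = [3/4] then - 56 else if K = [3/4, 1/3] then - 179 else - 118)"

text \<open>This lets the potential be dropped when the number of Best Fit bins is bounded from
  below.\<close>

lemma potential_nonpos: "potential K \<le> 0"
  by (auto simp: potential_def)

text \<open>The transitions of the chain. A new bin is opened only from \<open>[]\<close>, by either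
  size, and from \<open>[3/4]\<close>, by \<open>1/3\<close>.\<close>

lemma bf_insert_configurations:
  shows "bf_insert [] (1/4) = [1/4]"
    and "bf_insert [] (1/3) = [1/3]"
    and "bf_insert [1/4] (1/4) = [1/2]"
    and "bf_insert [1/4] (1/3) = [7/12]"
    and "bf_insert [1/3] (1/4) = [7/12]"
    and "bf_insert [1/3] (1/3) = [2/3]"
    and "bf_insert [1/2] (1/4) = [3/4]"
    and "bf_insert [1/2] (1/3) = [5/6]"
    and "bf_insert [7/12] (1/4) = [5/6]"
    and "bf_insert [7/12] (1/3) = [11/12]"
    and "bf_insert [2/3] (1/4) = [11/12]"
    and "bf_insert [2/3] (1/3) = [1]"
    and "bf_insert [3/4] (1/4) = [1]"
    and "bf_insert [3/4] (1/3) = [3/4, 1/3]"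
    and "bf_insert [3/4, 1/3] (1/4) = [1, 1/3]"
    and "bf_insert [3/4, 1/3] (1/3) = [3/4, 2/3]"
    and "bf_insert [3/4, 2/3] (1/4) = [1, 2/3]"
    and "bf_insert [3/4, 2/3] (1/3) = [3/4, 1]"
  by (simp_all add: bf_insert_def)

text \<open>The factor 2 clears the probability \<open>1/2\<close> of each size and 187 the
  denominators of \<open>h\<close>, so the Poisson equation becomes an integer identity to check in
  each of the nine states.\<close>

lemma potential_step_config:
  assumes "K \<in> configurations"
  shows "open_bins (bf_insert K (1/4)) \<in> configurations"
    and "open_bins (bf_insert K (1/3)) \<in> configurations"
    and "187 * real (length (bf_insert K (1/4))) + potential (open_bins (bf_insert K (1/4)))
       + 187 * real (length (bf_insert K (1/3))) + potential (open_bins (bf_insert K (1/3)))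
       = 2 * (187 * real (length K) + potential K + 60)"
proof -
  have "open_bins (bf_insert K (1/4)) \<in> configurations \<and> open_bins (bf_insert K (1/3)) \<in> configurations"
    using assms unfolding configurations_def
    by (elim insertE emptyE; simp add: bf_insert_configurations)
  then show "open_bins (bf_insert K (1/4)) \<in> configurations"
    "open_bins (bf_insert K (1/3)) \<in> configurations" by auto
  show "187 * real (length (bf_insert K (1/4))) + potential (open_bins (bf_insert K (1/4)))
       + 187 * real (length (bf_insert K (1/3))) + potential (open_bins (bf_insert K (1/3)))
       = 2 * (187 * real (length K) + potential K + 60)"
    using assms unfolding configurations_def
    by (elim insertE emptyE; simp only: bf_insert_configurations filter.simps; simp add: potential_def)
qed

text \<open>An insertion opens as many bins in \<open>L\<close> as in its open part, so the identity
  carries over.\<close>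

lemma potential_step:
  assumes "open_bins L \<in> configurations"
  shows "open_bins (bf_insert L (1/4)) \<in> configurations"
    and "open_bins (bf_insert L (1/3)) \<in> configurations"
    and "187 * real (length (bf_insert L (1/4))) + potential (open_bins (bf_insert L (1/4)))
       + 187 * real (length (bf_insert L (1/3))) + potential (open_bins (bf_insert L (1/3)))
       = 2 * (187 * real (length L) + potential (open_bins L) + 60)"
proof -
  note f4 = bf_insert_filter[of "1/4" "\<lambda>y. y \<le> 3/4" L]
    and f3 = bf_insert_filter[of "1/3" "\<lambda>y. y \<le> 3/4" L]
  note c = potential_step_config[OF assms]
  show "open_bins (bf_insert L (1/4)) \<in> configurations"
    "open_bins (bf_insert L (1/3)) \<in> configurations"
    using c(1,2) f4(1) f3(1) by auto
  have "real (length (bf_insert L (1/4))) + length (open_bins L)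
      = length L + real (length (bf_insert (open_bins L) (1/4)))"
    "real (length (bf_insert L (1/3))) + length (open_bins L)
      = length L + real (length (bf_insert (open_bins L) (1/3)))"
    using f4(2) f3(2) by linarith+
  moreover have "potential (open_bins (bf_insert L (1/4))) = potential (open_bins (bf_insert (open_bins L) (1/4)))"
    "potential (open_bins (bf_insert L (1/3))) = potential (open_bins (bf_insert (open_bins L) (1/3)))"
    using f4(1) f3(1) by auto
  ultimately show "187 * real (length (bf_insert L (1/4))) + potential (open_bins (bf_insert L (1/4)))
       + 187 * real (length (bf_insert L (1/3))) + potential (open_bins (bf_insert L (1/3)))
       = 2 * (187 * real (length L) + potential (open_bins L) + 60)"
    using c(3) by algebra
qed

section \<open>Averages over all words\<close>

abbreviation bf_loads :: "nat \<Rightarrow> nat set \<Rightarrow> real list" where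
  "bf_loads n A \<equiv> foldl bf_insert [] (word n A)"

lemma open_bins_bf_loads: "open_bins (bf_loads n A) \<in> configurations"
proof (induction n)
  case 0
  then show ?case by (simp add: word_def configurations_def)
next
  case (Suc n)
  have "word (Suc n) A = word n A @ [if n \<in> A then 1/4 else 1/3]"
    by (simp add: word_def)
  then show ?case using potential_step(1,2)[OF Suc] by simp
qed

text \<open>By the Poisson equation, averaging over the last item adds exactly 60 to the mean; the
  start contributes 0 since \<open>potential [] = 0\<close>.\<close>

lemma sum_BF_words:
  "(\<Sum>A\<in>Pow {..<n}. 187 * real (BF (word n A)) + potential (open_bins (bf_loads n A)))
   = 60 * real n * 2 ^ n"
proof -
  define F where "F n A = 187 * real (BF (word n A)) + potential (open_bins (bf_loads n A))" for n A
  have "(\<Sum>A\<in>Pow {..<n}. F n A) = 60 * real n * 2 ^ n"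
  proof (induction n)
    case 0
    then show ?case by (simp add: F_def word_def BF_def potential_def)
  next
    case (Suc n)
    have "(\<Sum>A\<in>Pow {..<Suc n}. F (Suc n) A) = (\<Sum>A\<in>Pow {..<n}. 2 * (F n A + 60))"
      unfolding sum_Pow_lessThan_Suc
    proof (intro sum.cong refl)
      fix A assume "A \<in> Pow {..<n}"
      then show "F (Suc n) A + F (Suc n) (insert n A) = 2 * (F n A + 60)"
        using potential_step(3)[OF open_bins_bf_loads, of n A] by (simp add: F_def word_Suc BF_def)
    qed
    also have "\<dots> = 2 * (60 * real n * 2 ^ n + 60 * 2 ^ n)"
      by (simp only: sum_distrib_left[symmetric] sum.distrib Suc) (simp add: card_Pow)
    finally show ?case by (simp add: algebra_simps)
  qed
  then show ?thesis by (simp only: F_def)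
qed

lemma sum_size_words:
  "(\<Sum>A\<in>Pow {..<n}. sum_list (word n A)) = 7 / 24 * real n * 2 ^ n"
proof (induction n)
  case 0
  then show ?case by (simp add: word_def)
next
  case (Suc n)
  \<comment> \<open>\<open>7/12\<close> is \<open>1/4 + 1/3\<close>, the size that the two
    extensions of a word add together.\<close>
  have "(\<Sum>A\<in>Pow {..<Suc n}. sum_list (word (Suc n) A))
    = (\<Sum>A\<in>Pow {..<n}. 2 * sum_list (word n A) + 7 / 12)"
    unfolding sum_Pow_lessThan_Suc by (intro sum.cong) (auto simp: word_Suc)
  also have "\<dots> = 2 * (7 / 24 * real n * 2 ^ n) + 7 / 12 * 2 ^ n"
    by (simp only: sum.distrib sum_distrib_left[symmetric] Suc) (simp add: card_Pow)
  finally show ?case by (simp add: algebra_simps)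
qed

text \<open>Each fixed permutation of the positions permutes the set of all words.\<close>

lemma sum_expected_BF_words:
  "(\<Sum>A\<in>Pow {..<n}. expected_BF (word n A)) = (\<Sum>A\<in>Pow {..<n}. real (BF (word n A)))"
proof -
  let ?P = "{\<sigma>. \<sigma> permutes {..<n}}"
  have inner: "(\<Sum>A\<in>Pow {..<n}. real (BF (word n (\<sigma> -` A)))) = (\<Sum>A\<in>Pow {..<n}. real (BF (word n A)))"
    if "\<sigma> permutes {..<n}" for \<sigma>
  proof (rule sum.reindex_bij_witness[where i = "image \<sigma>" and j = "vimage \<sigma>"])
    fix A
    show "\<sigma> ` \<sigma> -` A = A" "\<sigma> -` \<sigma> ` A = A"
      using permutes_surj[OF that] permutes_inj[OF that] by (auto simp: inj_vimage_image_eq)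
    show "\<sigma> -` A \<in> Pow {..<n}" if "A \<in> Pow {..<n}"
      using that permutes_in_image[OF \<open>\<sigma> permutes {..<n}\<close>] by auto
    show "\<sigma> ` A \<in> Pow {..<n}" if "A \<in> Pow {..<n}"
      using that permutes_in_image[OF \<open>\<sigma> permutes {..<n}\<close>] by auto
  qed simp
  have "(\<Sum>A\<in>Pow {..<n}. expected_BF (word n A))
    = (\<Sum>A\<in>Pow {..<n}. \<Sum>\<sigma>\<in>?P. real (BF (word n (\<sigma> -` A)))) / fact n"
    unfolding sum_divide_distrib by (intro sum.cong refl) (simp add: expected_BF_def permuted_word sum_divide_distrib)
  \<comment> \<open>With the permutation outermost all inner sums agree, and their number
    \<open>fact n\<close> cancels the denominator.\<close>
  also have "\<dots> = (\<Sum>\<sigma>\<in>?P. \<Sum>A\<in>Pow {..<n}. real (BF (word n (\<sigma> -` A)))) / fact n"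
    by (subst sum.swap) simp
  also have "\<dots> = (\<Sum>\<sigma>\<in>?P. \<Sum>A\<in>Pow {..<n}. real (BF (word n A))) / fact n"
    using inner by simp
  also have "\<dots> = (\<Sum>A\<in>Pow {..<n}. real (BF (word n A)))"
    by (simp add: card_permutations[of _ n])
  finally show ?thesis .
qed

subsection \<open>Optimal packings\<close>

lemma OPT_le: "feasible_packing I k f \<Longrightarrow> OPT I \<le> k"
  unfolding OPT_def by (rule Least_le) blast

lemma sum_list_le_OPT:
  assumes "valid_items I"
  shows "sum_list I \<le> real (OPT I)"
proof -
  \<comment> \<open>One item per bin is feasible, so the minimum in \<open>OPT\<close> is
    attained.\<close>
  have "feasible_packing I (length I) id"
    unfolding feasible_packing_def
  proof (intro conjI allI impI)
    fix b assume b: "b < length I"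
    then have "{i. i < length I \<and> id i = b} = {b}" by auto
    then show "(\<Sum>i\<in>{i. i < length I \<and> id i = b}. I ! i) \<le> 1"
      using assms b by (simp add: valid_items_def)
  qed simp
  then have "\<exists>k f. feasible_packing I k f" by blast
  then have "\<exists>f. feasible_packing I (OPT I) f"
    unfolding OPT_def by (rule LeastI_ex)
  then obtain f where f: "\<forall>i<length I. f i < OPT I"
    "\<forall>b<OPT I. (\<Sum>i\<in>{i. i < length I \<and> f i = b}. I ! i) \<le> 1"
    unfolding feasible_packing_def by blast
  have "sum_list I = (\<Sum>i\<in>{..<length I}. I ! i)"
    by (simp add: sum_list_sum_nth atLeast0LessThan)
  also have "\<dots> = (\<Sum>b\<in>{..<OPT I}. \<Sum>i\<in>{i \<in> {..<length I}. f i = b}. I ! i)"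
    by (rule sum.group[symmetric]) (use f in auto)
  also have "\<dots> \<le> (\<Sum>b\<in>{..<OPT I}. 1)"
    by (rule sum_mono) (use f in auto)
  finally show ?thesis by simp
qed

text \<open>The count is the rank of \<open>i\<close> in \<open>A\<close>, which increases strictly
  along \<open>A\<close>.\<close>

lemma inj_on_card_below: "inj_on (\<lambda>i. card {j \<in> A. j < i}) (A :: nat set)"
proof (rule linorder_inj_onI)
  fix x y assume "x < y" "x \<in> A" "y \<in> A"
  then have "{j \<in> A. j < x} \<subset> {j \<in> A. j < y}" by auto
  then have "card {j \<in> A. j < x} < card {j \<in> A. j < y}" by (intro psubset_card_mono) auto
  then show "card {j \<in> A. j < x} \<noteq> card {j \<in> A. j < y}" by simp
qed auto

text \<open>Elements of one block have distinct ranks in an interval of length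
  \<open>q\<close>.\<close>

lemma card_block_le:
  fixes A :: "nat set"
  assumes "0 < q"
  shows "card {i \<in> A. card {j \<in> A. j < i} div q = b} \<le> q"
proof -
  let ?S = "{i \<in> A. card {j \<in> A. j < i} div q = b}"
  let ?r = "\<lambda>i. card {j \<in> A. j < i}"
  have inj: "inj_on ?r ?S"
    using inj_on_card_below by (rule inj_on_subset) auto
  have "k \<in> {b * q..<b * q + q}" if "k div q = b" for k
    using that dividend_less_div_times[OF assms, of k] by (auto simp: add.commute)
  then have sub: "?r ` ?S \<subseteq> {b * q..<b * q + q}" by blast
  show ?thesis using card_inj_on_le[OF inj sub] by simp
qed

text \<open>Pack the quarters four to a bin and the thirds three to a bin.\<close>

lemma OPT_word_le:
  assumes "A \<subseteq> {..<n}"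
  shows "real (OPT (word n A)) \<le> sum_list (word n A) + 2"
proof -
  define B where "B = {..<n} - A"
  \<comment> \<open>The \<open>+ 1\<close> leaves room for an incomplete last bin of each kind;
    these are the two extra bins.\<close>
  define a where "a = card A div 4 + 1"
  define b where "b = card B div 3 + 1"
  define f where "f i = (if i \<in> A then card {j \<in> A. j < i} div 4
    else a + card {j \<in> B. j < i} div 3)" for i
  have fin: "finite A" "finite B" using assms by (auto simp: B_def finite_subset)
  have lt_a: "card {j \<in> A. j < i} div 4 < a" for i
    using div_le_mono[OF card_mono[OF fin(1), of "{j \<in> A. j < i}"], of 4] by (auto simp: a_def)
  have lt_b: "card {j \<in> B. j < i} div 3 < b" for i
    using div_le_mono[OF card_mono[OF fin(2), of "{j \<in> B. j < i}"], of 3] by (auto simp: b_def)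
  have "feasible_packing (word n A) (a + b) f"
    unfolding feasible_packing_def
  proof (intro conjI allI impI)
    show "f i < a + b" for i
      using lt_a[of i] lt_b[of i] by (auto simp: f_def)
    fix c
    show "(\<Sum>i\<in>{i. i < length (word n A) \<and> f i = c}. word n A ! i) \<le> 1"
    proof (cases "c < a")
      case True
      let ?S = "{i \<in> A. card {j \<in> A. j < i} div 4 = c}"
      have eq: "{i. i < length (word n A) \<and> f i = c} = ?S"
        using True assms by (auto simp: f_def)
      have "(\<Sum>i\<in>?S. word n A ! i) = (\<Sum>i\<in>?S. 1/4)"
        using assms by (intro sum.cong) (auto simp: nth_word)
      then show ?thesis using card_block_le[of 4 A c] unfolding eq by simp
    next
      case False
      let ?S = "{i \<in> B. card {j \<in> B. j < i} div 3 = c - a}"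
      have eq: "{i. i < length (word n A) \<and> f i = c} = ?S"
        using False assms lt_a by (auto simp: f_def B_def)
      have "(\<Sum>i\<in>?S. word n A ! i) = (\<Sum>i\<in>?S. 1/3)"
        using assms by (intro sum.cong) (auto simp: nth_word B_def)
      then show ?thesis using card_block_le[of 3 B "c - a"] unfolding eq by simp
    qed
  qed
  then have "real (OPT (word n A)) \<le> real (card A div 4) + real (card B div 3) + 2"
    using OPT_le[of "word n A" "a + b" f] by (simp add: a_def b_def)
  also have "\<dots> \<le> card A / 4 + card B / 3 + 2"
    using of_nat_div_le_of_nat[of "card A" 4] of_nat_div_le_of_nat[of "card B" 3] by simp
  also have "card A / 4 + card B / 3 = sum_list (word n A)"
  proof -
    have "sum_list (word n A) = (\<Sum>i\<in>{..<n}. if i \<in> A then 1/4 else 1/3)"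
      by (simp add: sum_list_sum_nth atLeast0LessThan nth_word)
    also have "\<dots> = card A / 4 + card B / 3"
      using assms by (simp add: sum.If_cases B_def Diff_eq Int_absorb1)
    finally show ?thesis by simp
  qed
  finally show ?thesis .
qed

section \<open>The averaging argument and the limit superior\<close>

text \<open>If every word stayed below the ratio, so would the totals over all words, against the
  lower bound on the Best Fit total.\<close>

lemma exists_bad_word:
  assumes "10 ^ 6 \<le> n"
  obtains A where "A \<subseteq> {..<n}" "expected_BF (word n A) \<ge> 22001/20000 * real (OPT (word n A))"
proof -
  \<comment> \<open>A rational strictly between \<open>11/10\<close> and
    \<open>1440/1309\<close>.\<close>
  let ?r = "22001/20000 :: real"
  have "\<exists>A\<in>Pow {..<n}. ?r * (sum_list (word n A) + 2) \<le> expected_BF (word n A)"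
  proof (rule ccontr)
    assume "\<not> ?thesis"
    then have "(\<Sum>A\<in>Pow {..<n}. expected_BF (word n A)) \<le> (\<Sum>A\<in>Pow {..<n}. ?r * (sum_list (word n A) + 2))"
      by (intro sum_mono) (auto simp: not_le less_imp_le)
    also have "\<dots> = ?r * (7 / 24 * real n * 2 ^ n + 2 * 2 ^ n)"
      by (simp only: sum_distrib_left[symmetric] sum.distrib sum_size_words) (simp add: card_Pow)
    finally have *: "(\<Sum>A\<in>Pow {..<n}. real (BF (word n A))) \<le> ?r * (7 / 24 * real n + 2) * 2 ^ n"
      by (simp add: sum_expected_BF_words algebra_simps)
    have "60 * real n * 2 ^ n \<le> (\<Sum>A\<in>Pow {..<n}. 187 * real (BF (word n A)))"
      unfolding sum_BF_words[symmetric] by (intro sum_mono) (use potential_nonpos in auto)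
    also have "\<dots> \<le> 187 * (?r * (7 / 24 * real n + 2) * 2 ^ n)"
      unfolding sum_distrib_left[symmetric] by (rule mult_left_mono[OF *]) simp
    finally have "60 * real n \<le> 187 * (?r * (7 / 24 * real n + 2))"
      by (simp add: mult.assoc[symmetric])
    \<comment> \<open>As \<open>60 - 187 * ?r * 7/24 > 0.0014\<close>, the linear terms differ by
      more than 1400 from \<open>10 ^ 6\<close> items on, while the constant \<open>374 * ?r\<close>
      is below 412.\<close>
    then show False using assms by simp
  qed
  then obtain A where A: "A \<subseteq> {..<n}" "?r * (sum_list (word n A) + 2) \<le> expected_BF (word n A)"
    by blast
  then have "?r * real (OPT (word n A)) \<le> expected_BF (word n A)"
    using OPT_word_le[OF A(1)] by argo
  with A(1) show thesis by (rule that)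
qed

text \<open>All items are at least \<open>1/4\<close>, so long words have arbitrarily large
  \<open>OPT\<close>, as the limit superior requires.\<close>

lemma length_le_OPT_word: "real n / 4 \<le> real (OPT (word n A))"
proof -
  have "real n / 4 = (\<Sum>i\<in>{..<n}. 1/4)" by simp
  also have "\<dots> \<le> (\<Sum>i\<in>{..<n}. word n A ! i)"
    by (intro sum_mono) (auto simp: nth_word)
  also have "\<dots> = sum_list (word n A)" by (simp add: sum_list_sum_nth atLeast0LessThan)
  also have "\<dots> \<le> real (OPT (word n A))" by (intro sum_list_le_OPT valid_items_word)
  finally show ?thesis .
qed

theorem theorem4:
  shows "RR_inf_BF > ereal (11/10)"
proof -
  let ?g = "\<lambda>k. SUP I\<in>{I. valid_items I \<and> OPT I = k}. ereal (expected_BF I / real (OPT I))"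
  have "ereal (22001/20000) \<le> RR_inf_BF"
    unfolding RR_inf_BF_def limsup_INF_SUP
  proof (rule INF_greatest)
    fix N :: nat
    \<comment> \<open>\<open>10 ^ 6\<close> meets the length bound for a bad word, and
      \<open>4 * N\<close> forces \<open>OPT\<close> above \<open>N\<close>.\<close>
    define n where "n = 10 ^ 6 + 4 * N"
    obtain A where A: "expected_BF (word n A) \<ge> 22001/20000 * real (OPT (word n A))"
      by (rule exists_bad_word[of n]) (auto simp: n_def)
    let ?k = "OPT (word n A)"
    have "real N < real ?k" using length_le_OPT_word[of n A] by (simp add: n_def)
    then have k: "N \<le> ?k" "0 < ?k" by auto
    have "ereal (22001/20000) \<le> ereal (expected_BF (word n A) / real ?k)"
      using A k by (simp add: le_divide_eq)
    also have "\<dots> \<le> ?g ?k"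
      by (rule SUP_upper) (simp add: valid_items_word)
    also have "\<dots> \<le> (SUP k\<in>{N..}. ?g k)"
      using k by (intro SUP_upper) simp
    finally show "ereal (22001/20000) \<le> (SUP k\<in>{N..}. ?g k)" .
  qed
  \<comment> \<open>Strictness comes from \<open>22001/20000 > 11/10\<close>.\<close>
  then show ?thesis by (rule less_le_trans[rotated]) simp
qed

end
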